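(* Let $(X,d)$ be a compact metric space and $\alpha:X\to X$ a continuous map that is a finite-sheeted cover on its essential set $X_\alpha$, i.e. $\sup_{x\in X_\alpha}|\alpha^{-1}(x)\cap X_\alpha|<\infty$. If $\alpha$ possesses Property $( * )$, then $\gamma(\alpha)=0$ (and hence $h(\alpha)=\omega(\alpha)$).
   Context: $M_\alpha(X)$ is the set of Borel $\alpha$-invariant probability measures on $X$. A point $x\in X$ is essential if every neighborhood $V$ of $x$ satisfies $\mu(V)>0$ for some $\mu\in M_\alpha(X)$; $X_\alpha$ is the (closed) set of essential points, and $\alpha(X_\alpha)=X_\alpha$. For $S\subset X_\alpha$ put $\tilde\alpha^{-n}(S):=\alpha^{-n}(S)\cap X_\alpha$, and $\tilde\alpha^{-n}(x):=\tilde\alpha^{-n}(\{x\})$. Put $d_n(x,y):=\max_{0\le i\le n-1}d(\alpha^i(x),\alpha^i(y))$. A set $E\subset X$ is $(n,\varepsilon)$-spanning if for every $x\in X$ there is $y\in E$ with $d_n(x,y)<\varepsilon$; a set $E\subset X_\alpha$ is $(n,\varepsilon)$-spanning for $X_\alpha$ if for every $x\in X_\alpha$ there is $y\in E$ with $d_n(x,y)<\varepsilon$. Property $( * )$: for each pair $(n,\varepsilon)$, $n\in\mathbb N$, $\varepsilon>0$, there exists a finite set $F(n,\varepsilon)\subset X_\alpha$ such that $\tilde\alpha^{-n}(F(n,\varepsilon))$ is $(n,\varepsilon)$-spanning for $X_\alpha$ and $\lim_{n\to\infty}|F(n,\varepsilon)|^{1/n}=1$ (for each $\varepsilon>0$).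 Topological entropy: $h(\alpha):=\ln\lim_{\varepsilon\to0}\limsup_{n\to\infty}\inf\{|E|^{1/n}: E \text{ is }(n,\varepsilon)\text{-spanning}\}$. Inverse rami-rate: $\omega(\alpha):=\ln\limsup_{n\to\infty}\sup_{x\in X_\alpha}|\tilde\alpha^{-n}(x)|^{1/n}$. Forward entropy: $\gamma(\alpha):=\ln\lim_{\varepsilon\to0}\limsup_{n\to\infty}\inf\{|\alpha^n(E)|^{1/n}: E\text{ is }(n,\varepsilon)\text{-spanning for }X_\alpha\}$.
   Formalization: With only the bound on |α^{-1}(x)∩X_α|, h(α)=ω(α) can fail (h<ω is possible); so h(α)=ω(α) is stated when α is a topological covering map of X_α onto itself, while γ(α)=0 and h(α)≤ω(α) are stated under the bound alone. *)

theory Defs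
  imports "HOL-Probability.Probability"
begin

text \<open>The compact metric space is the whole type \<^typ>\<open>'a\<close>; in particular it is nonempty.\<close>

definition invariant_measures :: "('a::metric_space \<Rightarrow> 'a) \<Rightarrow> 'a measure set" where
  "invariant_measures \<alpha> =
     {\<mu>. prob_space \<mu> \<and> sets \<mu> = sets borel \<and>
          (\<forall>B\<in>sets borel. emeasure \<mu> (\<alpha> -` B) = emeasure \<mu> B)}"

text \<open>Only open neighborhoods are tested: an arbitrary neighborhood contains an open one
  and need not be Borel.\<close>

definition essential_set :: "('a::metric_space \<Rightarrow> 'a) \<Rightarrow> 'a set" where
  "essential_set \<alpha> =
     {x. \<forall>V. open V \<longrightarrow> x \<in> V \<longrightarrow> (\<exists>\<mu>\<in>invariant_measures \<alpha>. emeasure \<mu> V > 0)}"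

definition essential_preimage :: "('a::metric_space \<Rightarrow> 'a) \<Rightarrow> nat \<Rightarrow> 'a set \<Rightarrow> 'a set" where
  "essential_preimage \<alpha> n S = ((\<alpha> ^^ n) -` S) \<inter> essential_set \<alpha>"

definition finite_sheeted :: "('a::metric_space \<Rightarrow> 'a) \<Rightarrow> bool" where
  "finite_sheeted \<alpha> \<longleftrightarrow>
     (\<exists>N. \<forall>x\<in>essential_set \<alpha>.
        finite (essential_preimage \<alpha> 1 {x}) \<and> card (essential_preimage \<alpha> 1 {x}) \<le> N)"

text \<open>The Bowen distance is meaningful for \<open>n \<ge> 1\<close> only; below, \<open>n = 0\<close> is either excluded
  or irrelevant for the limit in \<open>n\<close>.\<close>

definition bowen_dist :: "('a::metric_space \<Rightarrow> 'a) \<Rightarrow> nat \<Rightarrow> 'a \<Rightarrow> 'a \<Rightarrow> real" where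
  "bowen_dist \<alpha> n x y = Max ((\<lambda>i. dist ((\<alpha> ^^ i) x) ((\<alpha> ^^ i) y)) ` {..<n})"

definition spanning_for ::
    "('a::metric_space \<Rightarrow> 'a) \<Rightarrow> 'a set \<Rightarrow> nat \<Rightarrow> real \<Rightarrow> 'a set \<Rightarrow> bool" where
  "spanning_for \<alpha> Y n \<epsilon> E \<longleftrightarrow> E \<subseteq> Y \<and> (\<forall>x\<in>Y. \<exists>y\<in>E. bowen_dist \<alpha> n x y < \<epsilon>)"

definition property_star :: "('a::metric_space \<Rightarrow> 'a) \<Rightarrow> bool" where
  "property_star \<alpha> \<longleftrightarrow>
     (\<exists>F :: nat \<Rightarrow> real \<Rightarrow> 'a set.
        (\<forall>n>0. \<forall>\<epsilon>>0. finite (F n \<epsilon>) \<and> F n \<epsilon> \<subseteq> essential_set \<alpha> \<and>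
           spanning_for \<alpha> (essential_set \<alpha>) n \<epsilon> (essential_preimage \<alpha> n (F n \<epsilon>))) \<and>
        (\<forall>\<epsilon>>0. (\<lambda>n. root n (real (card (F n \<epsilon>)))) \<longlonglongrightarrow> 1))"

text \<open>\<open>|A|\<^sup>1\<^sup>/\<^sup>n\<close>, with value \<open>\<infinity>\<close> for infinite \<open>A\<close> (where \<^const>\<open>card\<close> would give \<open>0\<close>).\<close>

definition card_root :: "nat \<Rightarrow> 'a set \<Rightarrow> ereal" where
  "card_root n A = (if finite A then ereal (root n (real (card A))) else \<infinity>)"

text \<open>The continuous extension of \<^term>\<open>ln\<close> to \<open>[0,\<infinity>]\<close>.\<close>

definition ln_ereal :: "ereal \<Rightarrow> ereal" where
  "ln_ereal x =
     (if x \<le> 0 then - \<infinity> else if x = \<infinity> then \<infinity> else ereal (ln (real_of_ereal x)))"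

definition topological_entropy :: "('a::metric_space \<Rightarrow> 'a) \<Rightarrow> ereal" where
  "topological_entropy \<alpha> = ln_ereal (Lim (at_right 0) (\<lambda>\<epsilon>::real.
     limsup (\<lambda>n. INF E\<in>{E. spanning_for \<alpha> UNIV n \<epsilon> E}. card_root n E)))"

definition inverse_rami_rate :: "('a::metric_space \<Rightarrow> 'a) \<Rightarrow> ereal" where
  "inverse_rami_rate \<alpha> = ln_ereal
     (limsup (\<lambda>n. SUP x\<in>essential_set \<alpha>. card_root n (essential_preimage \<alpha> n {x})))"

definition forward_entropy :: "('a::metric_space \<Rightarrow> 'a) \<Rightarrow> ereal" where
  "forward_entropy \<alpha> = ln_ereal (Lim (at_right 0) (\<lambda>\<epsilon>::real.
     limsup (\<lambda>n. INF E\<in>{E. spanning_for \<alpha> (essential_set \<alpha>) n \<epsilon> E}.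
       card_root n ((\<alpha> ^^ n) ` E))))"

end

theory Submission
  imports Defs
begin

text \<open>
  Property \<open>(*)\<close> bounds \<open>\<alpha>\<^sup>n(E)\<close> by \<open>|F(n,\<epsilon>)|\<close> for a spanning set \<open>E\<close> of the essential set \<open>X\<^sub>\<alpha>\<close>,
  whence \<open>\<gamma>(\<alpha>) = 0\<close>; it also bounds \<open>|E|\<close> by \<open>|F(n,\<epsilon>)|\<close> times the largest fibre cardinality,
  so that the entropy of \<open>\<alpha>\<close> on \<open>X\<^sub>\<alpha>\<close> is at most \<open>\<omega>(\<alpha>)\<close>.

  Passing from \<open>X\<^sub>\<alpha>\<close> to \<open>X\<close> needs no variational principle. By a Krylov-Bogoliubov argument orbits
  visit a closed set disjoint from \<open>X\<^sub>\<alpha>\<close> with uniformly vanishing frequency, because a limit of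
  empirical measures would otherwise charge it. An orbit segment of length \<open>n\<close> therefore splits into
  blocks of length \<open>m\<close> that are shadowed by an \<open>(m,\<epsilon>)\<close>-spanning set of \<open>X\<^sub>\<alpha>\<close>, and \<open>o(n)\<close> single
  steps; counting these itineraries shows that \<open>X\<close> has no more entropy than \<open>X\<^sub>\<alpha>\<close>.

  If \<open>\<alpha>\<close> is a covering of \<open>X\<^sub>\<alpha>\<close> by itself, it is injective on uniformly small sets, so the points of a
  fibre of \<open>\<alpha>\<^sup>n\<close> are \<open>(n,\<epsilon>)\<close>-separated, which gives \<open>\<omega>(\<alpha>) \<le> h(\<alpha>)\<close>.
\<close>

section \<open>Invariant measures from empirical frequencies\<close>

text \<open>Lebesgue number: every point of \<open>K\<close> has its whole \<open>e\<close>-ball in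
  \<open>U\<close> or in \<open>V\<close>. Closing up either class of points does not leave
  \<open>U\<close> or \<open>V\<close>, since a limit point lies in the \<open>e\<close>-ball of a
  member.\<close>

lemma closed_cover_two_split:
  fixes K U V :: "'a::metric_space set"
  assumes "compact (UNIV :: 'a set)" "closed K" "open U" "open V" "K \<subseteq> U \<union> V"
  obtains A B where "closed A" "closed B" "A \<subseteq> U" "B \<subseteq> V" "K = A \<union> B"
proof -
  have "compact K" using assms(1,2) by (metis closed_Int_compact inf_top_right)
  then obtain e where e: "e > 0" "\<And>x. x \<in> K \<Longrightarrow> \<exists>G\<in>{U, V}. ball x e \<subseteq> G"
    using Heine_Borel_lemma[of K "{U, V}"] assms by auto
  have *: "closure {x. ball x e \<subseteq> W} \<subseteq> W" for W :: "'a set"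
  proof
    fix x assume "x \<in> closure {x. ball x e \<subseteq> W}"
    then obtain y where "ball y e \<subseteq> W" "dist y x < e"
      using e(1) unfolding closure_approachable by blast
    then show "x \<in> W" by (meson mem_ball subsetD)
  qed
  show ?thesis
  proof (rule that)
    show "K = K \<inter> closure {x. ball x e \<subseteq> U} \<union> K \<inter> closure {x. ball x e \<subseteq> V}"
    proof -
      have "x \<in> closure {x. ball x e \<subseteq> U} \<or> x \<in> closure {x. ball x e \<subseteq> V}" if "x \<in> K" for x
        using e(2)[OF that] closure_subset[of "{x. ball x e \<subseteq> U}"]
          closure_subset[of "{x. ball x e \<subseteq> V}"] by auto
      then show ?thesis by blast
    qed
  qed (use * assms in auto)
qed

text \<open>Only the values of \<open>m\<close> on closed sets enter; \<open>m\<close> itself may fail to be \<open>\<sigma>\<close>-additive on Borel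
  sets, so \<open>\<mu>\<close> need not extend \<open>m\<close>.\<close>

lemma exists_measure_of_content:
  fixes m :: "'a::metric_space set \<Rightarrow> real"
  assumes cpt: "compact (UNIV :: 'a set)"
    and nonneg: "\<And>A. 0 \<le> m A"
    and additive: "\<And>A B. A \<inter> B = {} \<Longrightarrow> m (A \<union> B) = m A + m B"
  shows "\<exists>\<mu>. sets \<mu> = sets borel \<and>
    (\<forall>U. open U \<longrightarrow> emeasure \<mu> U = (SUP K\<in>{K. closed K \<and> K \<subseteq> U}. ennreal (m K))) \<and>
    (\<forall>K. closed K \<longrightarrow> ennreal (m K) \<le> emeasure \<mu> K)"
proof -
  have empty [simp]: "m {} = 0" using additive[of "{}" "{}"] by simp
  have mono: "m A \<le> m B" if "A \<subseteq> B" for A B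
    using additive[of A "B - A"] nonneg[of "B - A"] that by (simp add: Un_absorb1)
  have subadd: "m (A \<union> B) \<le> m A + m B" for A B
    using additive[of A "B - A"] mono[of "B - A" B] by simp
  \<comment> \<open>Inner values on open sets. Outer approximation by open sets then gives the outer
    measure \<open>f\<close>, to which Caratheodory's theorem applies.\<close>
  define l where "l U = (SUP K\<in>{K. closed K \<and> K \<subseteq> U}. ennreal (m K))" for U
  have l_mono: "l U \<le> l V" if "U \<subseteq> V" for U V
    unfolding l_def using that by (intro SUP_subset_mono) auto
  have l_ge: "ennreal (m K) \<le> l U" if "closed K" "K \<subseteq> U" for K U
    unfolding l_def using that by (intro SUP_upper) auto
  have l_empty: "l {} = 0"
    unfolding l_def by (auto intro!: antisym SUP_least)
  have l_Un: "l (U \<union> V) \<le> l U + l V" if "open U" "open V" for U V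
    unfolding l_def[of "U \<union> V"]
  proof (intro SUP_least; safe)
    fix K assume "closed K" "K \<subseteq> U \<union> V"
    then obtain A B where AB: "closed A" "closed B" "A \<subseteq> U" "B \<subseteq> V" "K = A \<union> B"
      using closed_cover_two_split[OF cpt] \<open>open U\<close> \<open>open V\<close> by metis
    have "ennreal (m K) \<le> ennreal (m A) + ennreal (m B)"
      using subadd[of A B] AB(5) nonneg by (simp flip: ennreal_plus)
    also have "\<dots> \<le> l U + l V" using AB by (intro add_mono l_ge)
    finally show "ennreal (m K) \<le> l U + l V" .
  qed
  have l_Un_fin: "l (\<Union>i<n. U i) \<le> (\<Sum>i<n. l (U i))" if "\<And>i. open (U i)" for U :: "nat \<Rightarrow> _" and n
  proof (induction n)
    case 0
    then show ?case by (simp add: l_empty)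
  next
    case (Suc n)
    have "l (\<Union>i<Suc n. U i) \<le> l (\<Union>i<n. U i) + l (U n)"
      using l_Un[of "\<Union>i<n. U i" "U n"] that by (simp add: lessThan_Suc Un_commute open_UN)
    also have "\<dots> \<le> (\<Sum>i<Suc n. l (U i))" using Suc by (simp add: add_mono)
    finally show ?case .
  qed
  have l_UN: "l (\<Union>i. U i) \<le> (\<Sum>i. l (U i))" if op: "\<And>i. open (U i)" for U :: "nat \<Rightarrow> _"
    unfolding l_def[of "\<Union>i. U i"]
  proof (intro SUP_least; safe)
    fix K assume K: "closed K" "K \<subseteq> (\<Union>i. U i)"
    have "compact K" using cpt K(1) by (metis closed_Int_compact inf_top_right)
    then obtain I where I: "finite I" "K \<subseteq> (\<Union>i\<in>I. U i)"
      using K(2) op by (metis compactE_image)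
    obtain n where n: "I \<subseteq> {..<n}" using finite_nat_bounded[OF I(1)] by auto
    have "ennreal (m K) \<le> l (\<Union>i<n. U i)" using I n K(1) by (intro l_ge) auto
    also have "\<dots> \<le> (\<Sum>i<n. l (U i))" by (intro l_Un_fin op)
    also have "\<dots> \<le> (\<Sum>i. l (U i))" by (intro sum_le_suminf) auto
    finally show "ennreal (m K) \<le> (\<Sum>i. l (U i))" .
  qed
  \<comment> \<open>The constant \<open>c\<close> may be moved into the supremum because the family
    of closed subsets is nonempty: it contains \<open>{}\<close>.\<close>
  have l_add_le: "l U + c \<le> b"
    if "\<And>K. closed K \<Longrightarrow> K \<subseteq> U \<Longrightarrow> ennreal (m K) + c \<le> b" for U b c
  proof -
    have "{K. closed K \<and> K \<subseteq> U} \<noteq> {}" using closed_empty by blast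
    then show ?thesis
      unfolding l_def using that by (subst ennreal_SUP_add_left[symmetric]) (auto intro!: SUP_least)
  qed
  define f where "f A = (INF U\<in>{U. open U \<and> A \<subseteq> U}. l U)" for A
  have f_le: "f A \<le> l U" if "open U" "A \<subseteq> U" for A U
    unfolding f_def using that by (intro INF_lower) auto
  have f_close: "\<exists>U. open U \<and> A \<subseteq> U \<and> l U < c" if "f A < c" for A c
    using that by (auto simp: f_def INF_less_iff)
  have f_open: "f U = l U" if "open U" for U
    by (intro antisym f_le that order_refl) (auto simp: f_def intro!: INF_greatest l_mono)
  have f_mono: "f A \<le> f B" if "A \<subseteq> B" for A B
    unfolding f_def using that by (intro INF_superset_mono) auto
  have oms: "outer_measure_space (Pow UNIV) f"
    unfolding outer_measure_space_def
  proof (intro conjI)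
    show "positive (Pow UNIV) f" by (simp add: positive_def f_open l_empty)
    show "increasing (Pow UNIV) f" by (simp add: increasing_def f_mono)
    show "countably_subadditive (Pow UNIV) f"
      unfolding countably_subadditive_def
    proof (intro allI impI)
      fix A :: "nat \<Rightarrow> 'a set"
      show "f (\<Union>i. A i) \<le> (\<Sum>i. f (A i))"
      proof (rule ennreal_le_epsilon)
        fix e :: real assume e: "0 < e" and "(\<Sum>i. f (A i)) < top"
        \<comment> \<open>Finiteness of the sum makes every \<open>f (A n)\<close> finite, hence the
          strict inequality. The errors \<open>e * (1/2)^Suc n\<close> add up to
          \<open>e\<close>.\<close>
        then have "f (A n) < f (A n) + e * (1/2)^Suc n" for n
          by (auto simp add: less_top dest!: ennreal_suminf_lessD)
        then have "\<exists>U. open U \<and> A n \<subseteq> U \<and> l U < f (A n) + e * (1/2)^Suc n" for n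
          using f_close by blast
        then obtain U where U: "\<And>n. open (U n)" "\<And>n. A n \<subseteq> U n"
          "\<And>n. l (U n) < f (A n) + e * (1/2)^Suc n"
          by metis
        have "f (\<Union>i. A i) \<le> l (\<Union>i. U i)" using U by (intro f_le) auto
        also have "\<dots> \<le> (\<Sum>n. l (U n))" by (intro l_UN U)
        also have "\<dots> \<le> (\<Sum>n. f (A n) + e * (1/2) ^ Suc n)"
          using U(3) by (intro suminf_le less_imp_le) auto
        also have "... = (\<Sum>n. f (A n)) + (\<Sum>n. ennreal e * ennreal ((1/2) ^ Suc n))"
          using \<open>0 < e\<close> by (subst suminf_add[symmetric])
            (auto simp del: ennreal_suminf_cmult simp add: ennreal_mult[symmetric])
        also have "\<dots> = (\<Sum>n. f (A n)) + e"
          unfolding ennreal_suminf_cmult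
          by (subst suminf_ennreal_eq[OF zero_le_power power_half_series]) auto
        finally show "f (\<Union>i. A i) \<le> (\<Sum>n. f (A n)) + e" .
      qed
    qed
  qed
  define L where "L = lambda_system UNIV (Pow UNIV) f"
  have ms: "measure_space UNIV L f"
    unfolding L_def by (rule sigma_algebra.caratheodory_lemma[OF sigma_algebra_Pow oms])
  \<comment> \<open>The nontrivial half of Caratheodory's criterion for \<open>V\<close>: exhaust
    \<open>U \<inter> V\<close> by closed \<open>K\<close>, then the open superset
    \<open>U - K\<close> of \<open>A - V\<close> by closed \<open>M\<close>. As \<open>K\<close> and
    \<open>M\<close> are disjoint, \<open>m\<close> is additive on them.\<close>
  have split_le: "f (A \<inter> V) + f (A - V) \<le> l U" if V: "open V" and U: "open U" "A \<subseteq> U" for A U V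
  proof -
    have "l (U \<inter> V) + f (A - V) \<le> l U"
    proof -
      have "ennreal (m K) + f (A - V) \<le> l U" if K: "closed K" "K \<subseteq> U \<inter> V" for K
      proof -
        have "f (A - V) \<le> l (U - K)"
          using U V K by (intro f_le open_Diff) auto
        moreover have "ennreal (m K) + l (U - K) \<le> l U"
        proof -
          have "ennreal (m K) + ennreal (m M) \<le> l U" if "closed M" "M \<subseteq> U - K" for M
          proof -
            have "m (K \<union> M) = m K + m M" using that by (intro additive) auto
            then have "ennreal (m K) + ennreal (m M) = ennreal (m (K \<union> M))"
              using nonneg by simp
            also have "\<dots> \<le> l U" using that K by (intro l_ge) auto
            finally show ?thesis .
          qed
          then show ?thesis using l_add_le[of "U - K" "ennreal (m K)"] by (simp add: add.commute)
        qed
        ultimately show ?thesis by (meson add_left_mono order_trans)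
      qed
      then show ?thesis by (intro l_add_le)
    qed
    moreover have "f (A \<inter> V) \<le> l (U \<inter> V)" using U V by (intro f_le) auto
    ultimately show ?thesis by (meson add_right_mono order_trans)
  qed
  have sa: "subadditive (Pow UNIV) f"
    using oms unfolding outer_measure_space_def
    by (intro ring_of_sets.countably_subadditive_subadditive[OF ring_of_sets_Pow]) auto
  have open_L: "V \<in> L" if V: "open V" for V
  proof -
    have "f (A \<inter> V) + f (A - V) = f A" for A
    proof (rule antisym)
      show "f (A \<inter> V) + f (A - V) \<le> f A"
        unfolding f_def[of A] by (intro INF_greatest split_le V) auto
      have "f ((A \<inter> V) \<union> (A - V)) \<le> f (A \<inter> V) + f (A - V)"
        using subadditiveD[OF sa, of "A \<inter> V" "A - V"] by auto
      then show "f A \<le> f (A \<inter> V) + f (A - V)" by (simp add: Int_Diff_Un)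
    qed
    then show ?thesis
      unfolding L_def algebra.lambda_system_eq[OF sigma_algebra.axioms(1)[OF sigma_algebra_Pow]]
      by simp
  qed
  have borel_L: "sets borel \<subseteq> L"
  proof -
    have "sigma_sets UNIV {S :: 'a set. open S} \<subseteq> L"
      using ms open_L by (intro sigma_algebra.sigma_sets_subset) (auto simp: measure_space_def)
    then show ?thesis by (simp add: borel_def)
  qed
  have ms': "measure_space UNIV (sets borel) f"
    using measure_down[OF ms _ borel_L] sets.sigma_algebra_axioms[of borel] by auto
  define \<mu> where "\<mu> = measure_of UNIV (sets borel) f"
  have sets: "sets \<mu> = sets borel"
    using sets.sigma_sets_eq[of "borel :: 'a measure"] by (simp add: \<mu>_def sets_measure_of)
  have em: "emeasure \<mu> A = f A" if "A \<in> sets borel" for A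
    unfolding \<mu>_def using ms' that
    by (intro emeasure_measure_of_sigma) (auto simp: measure_space_def)
  show ?thesis
  proof (intro exI[of _ \<mu>] conjI allI impI)
    show "emeasure \<mu> U = (SUP K\<in>{K. closed K \<and> K \<subseteq> U}. ennreal (m K))" if "open U" for U
      using that by (simp add: em f_open l_def)
    show "ennreal (m K) \<le> emeasure \<mu> K" if "closed K" for K
      unfolding em[OF borel_closed[OF that]] f_def using that by (auto intro!: INF_greatest l_ge)
    show "sets \<mu> = sets borel" by (rule sets)
  qed
qed

text \<open>Carries every closed condition met by the empirical frequencies over to their cluster
  point.\<close>

lemma cluster_point_mem_closed:
  assumes "inf (nhds x) F \<noteq> bot" "closed C" "eventually (\<lambda>y. y \<in> C) F"
  shows "x \<in> C"
proof (rule ccontr)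
  assume "x \<notin> C"
  then have "eventually (\<lambda>y. y \<in> - C) (nhds x)"
    using assms(2) by (intro eventually_nhds_in_open) auto
  then have "eventually (\<lambda>y. False) (inf (nhds x) F)"
    using assms(3) unfolding eventually_inf
    by (intro exI[of _ "\<lambda>y. y \<in> - C"] exI[of _ "\<lambda>y. y \<in> C"]) auto
  then have "inf (nhds x) F = bot" by (simp only: eventually_False)
  with assms(1) show False ..
qed

text \<open>A cluster point in the product topology, by Tychonoff; a convergent subsequence need not exist.\<close>

lemma exists_cluster_function:
  fixes p :: "nat \<Rightarrow> 'b \<Rightarrow> real"
  assumes "\<And>k A. p k A \<in> {0..1}"
  shows "\<exists>m. inf (nhds m) (filtermap p sequentially) \<noteq> bot"
proof -
  have "compactin (product_topology (\<lambda>i::'b. euclidean) UNIV) (PiE UNIV (\<lambda>_. {0..1::real}))"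
    unfolding compactin_PiE by (simp add: compactin_euclidean_iff)
  then have "compact (PiE UNIV (\<lambda>_. {0..1::real}) :: ('b \<Rightarrow> real) set)"
    by (simp add: euclidean_product_topology compactin_euclidean_iff)
  moreover have "eventually (\<lambda>x. x \<in> PiE UNIV (\<lambda>_. {0..1::real})) (filtermap p sequentially)"
    using assms by (simp add: eventually_filtermap PiE_UNIV_domain)
  moreover have "filtermap p sequentially \<noteq> bot" by (simp add: filtermap_bot_iff)
  ultimately obtain m where "inf (nhds m) (filtermap p sequentially) \<noteq> bot"
    unfolding compact_filter by (elim allE[of _ "filtermap p sequentially"]) auto
  then show ?thesis by (rule exI[of _ m])
qed

section \<open>Visit frequencies and the Krylov-Bogoliubov theorem\<close>

definition visits :: "('a \<Rightarrow> 'a) \<Rightarrow> 'a set \<Rightarrow> nat \<Rightarrow> 'a \<Rightarrow> nat" where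
  "visits \<alpha> K n x = (\<Sum>i<n. of_bool ((\<alpha> ^^ i) x \<in> K))"

lemma visits_0 [simp]: "visits \<alpha> K 0 x = 0"
  by (simp add: visits_def)

lemma visits_Suc: "visits \<alpha> K (Suc n) x = visits \<alpha> K n x + of_bool ((\<alpha> ^^ n) x \<in> K)"
  by (simp add: visits_def)

lemma visits_Suc_shift: "visits \<alpha> K (Suc n) x = of_bool (x \<in> K) + visits \<alpha> K n (\<alpha> x)"
  unfolding visits_def by (subst sum.lessThan_Suc_shift) (simp add: funpow_swap1)

lemma visits_le: "visits \<alpha> K n x \<le> n"
  by (induction n) (auto simp: visits_Suc)

lemma visits_UNIV: "visits \<alpha> UNIV n x = n"
  by (simp add: visits_def)

lemma visits_Un: "A \<inter> B = {} \<Longrightarrow> visits \<alpha> (A \<union> B) n x = visits \<alpha> A n x + visits \<alpha> B n x"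
  by (induction n) (auto simp: visits_Suc)

lemma visits_funpow_le: "visits \<alpha> K (n - m) ((\<alpha> ^^ m) x) \<le> visits \<alpha> K n x"
proof (induction m arbitrary: n x)
  case (Suc m)
  show ?case
  proof (cases n)
    case (Suc n')
    have "visits \<alpha> K (n' - m) ((\<alpha> ^^ m) (\<alpha> x)) \<le> visits \<alpha> K n' (\<alpha> x)" by (rule Suc.IH)
    then show ?thesis by (simp add: Suc visits_Suc_shift funpow_swap1)
  qed simp
qed simp

text \<open>Telescoping: the two counts run over the same orbit shifted by one step, so only its end
  points \<open>x\<close> and \<open>(\<alpha> ^^ n) x\<close> matter. After division by
  \<open>n\<close>, empirical measures are almost invariant.\<close>

lemma visits_vimage_diff: "\<bar>real (visits \<alpha> (\<alpha> -` A) n x) - real (visits \<alpha> A n x)\<bar> \<le> 1"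
proof -
  have "visits \<alpha> (\<alpha> -` A) n x = visits \<alpha> A n (\<alpha> x)"
    by (simp add: visits_def funpow_swap1)
  then have "of_bool (x \<in> A) + visits \<alpha> (\<alpha> -` A) n x = visits \<alpha> A n x + of_bool ((\<alpha> ^^ n) x \<in> A)"
    using visits_Suc[of \<alpha> A n x] visits_Suc_shift[of \<alpha> A n x] by simp
  then show ?thesis by (auto simp: of_bool_def split: if_splits)
qed

text \<open>Open sets are an intersection-stable generator of the Borel sets, so two finite measures
  agreeing on them coincide. Open sets are also where the constructed measure is given by a
  formula.\<close>

lemma invariant_measureI:
  assumes "prob_space \<mu>" "sets \<mu> = sets borel" "continuous_on UNIV \<alpha>"
    and open_inv: "\<And>U. open U \<Longrightarrow> emeasure \<mu> (\<alpha> -` U) = emeasure \<mu> U"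
  shows "\<mu> \<in> invariant_measures \<alpha>"
proof -
  interpret prob_space \<mu> by fact
  have meas: "\<alpha> \<in> measurable \<mu> \<mu>"
    using borel_measurable_continuous_onI[OF assms(3)] measurable_cong_sets[OF assms(2) assms(2)]
    by blast
  have space: "space \<mu> = UNIV" using sets_eq_imp_space_eq[OF assms(2)] by simp
  have "distr \<mu> \<mu> \<alpha> = \<mu>"
  proof (rule measure_eqI_generator_eq[where \<Omega> = UNIV and E = "{U. open U}" and A = "\<lambda>_. UNIV"])
    show "emeasure (distr \<mu> \<mu> \<alpha>) U = emeasure \<mu> U" if "U \<in> {U. open U}" for U
      using that assms(2) open_inv[of U] by (simp add: emeasure_distr[OF meas] space)
    show "sets (distr \<mu> \<mu> \<alpha>) = sigma_sets UNIV {U. open U}" "sets \<mu> = sigma_sets UNIV {U. open U}"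
      using assms(2) by (simp_all add: borel_def)
    show "emeasure (distr \<mu> \<mu> \<alpha>) UNIV \<noteq> \<infinity>" for i :: nat
      using open_inv[of UNIV] assms(2) emeasure_finite[of UNIV]
      by (simp add: emeasure_distr[OF meas])
  qed (auto simp: Int_stable_def)
  then have "emeasure \<mu> (\<alpha> -` B) = emeasure \<mu> B" if "B \<in> sets borel" for B
    using emeasure_distr[OF meas, of B] that by (simp add: assms(2) space)
  then show ?thesis using assms(1,2) by (simp add: invariant_measures_def)
qed

text \<open>A cluster point \<open>m\<close> of the empirical frequencies is a finitely additive,
  invariant probability content with \<open>m K \<ge> \<delta>\<close>: each property is a closed
  condition on finitely many coordinates. The base points may vary with the length, which later
  gives uniformity in \<open>x\<close>.\<close>

lemma krylov_bogoliubov: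
  fixes \<alpha> :: "'a::metric_space \<Rightarrow> 'a"
  assumes cpt: "compact (UNIV :: 'a set)" and cont: "continuous_on UNIV \<alpha>"
    and K: "closed K"
    and freq: "\<And>N. \<exists>n\<ge>N. \<exists>x. \<delta> * real n \<le> real (visits \<alpha> K n x)"
  shows "\<exists>\<mu>\<in>invariant_measures \<alpha>. ennreal \<delta> \<le> emeasure \<mu> K"
proof -
  obtain n x where n: "\<And>k. Suc k \<le> n k" and x: "\<And>k. \<delta> * real (n k) \<le> real (visits \<alpha> K (n k) (x k))"
  proof -
    \<comment> \<open>Asking for \<open>Suc k \<le> n\<close> makes the lengths unbounded and keeps
      them positive, so that frequencies can be formed.\<close>
    have "\<forall>k. \<exists>n x. Suc k \<le> n \<and> \<delta> * real n \<le> real (visits \<alpha> K n x)"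
      using freq by blast
    then show ?thesis using that by metis
  qed
  have n_pos: "n k > 0" for k using n[of k] by simp
  define p where "p k A = real (visits \<alpha> A (n k) (x k)) / real (n k)" for k A
  have "p k A \<in> {0..1}" for k A
    using visits_le[of \<alpha> A "n k" "x k"] n_pos[of k] by (simp add: p_def)
  then obtain m where m: "inf (nhds m) (filtermap p sequentially) \<noteq> bot"
    using exists_cluster_function by blast
  have coord [continuous_intros]: "continuous_on UNIV (\<lambda>q :: 'a set \<Rightarrow> real. q A)" for A
    by (rule continuous_on_product_coordinates)
  have limit: "m \<in> C" if "closed C" "\<And>k. p k \<in> C" for C
    using cluster_point_mem_closed[OF m that(1)] that(2) by (simp add: eventually_filtermap)
  have nonneg: "0 \<le> m A" for A
  proof -
    have "m \<in> {q. 0 \<le> q A}"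
      by (rule limit) (auto intro!: closed_Collect_le continuous_intros simp: p_def)
    then show ?thesis by simp
  qed
  have total: "m UNIV = 1"
  proof -
    have "m \<in> {q. q UNIV = 1}"
      using n_pos by (intro limit) (auto intro!: closed_Collect_eq continuous_intros simp: p_def visits_UNIV)
    then show ?thesis by simp
  qed
  have add: "m (A \<union> B) = m A + m B" if "A \<inter> B = {}" for A B
  proof -
    have "m \<in> {q. q (A \<union> B) = q A + q B}"
      using that by (intro limit)
        (auto intro!: closed_Collect_eq continuous_intros simp: p_def visits_Un add_divide_distrib)
    then show ?thesis by simp
  qed
  have K_ge: "\<delta> \<le> m K"
  proof -
    have "m \<in> {q. \<delta> \<le> q K}"
      using x n_pos by (intro limit)
        (auto intro!: closed_Collect_le continuous_intros simp: p_def pos_le_divide_eq)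
    then show ?thesis by simp
  qed
  have inv: "m (\<alpha> -` A) = m A" for A
  proof -
    \<comment> \<open>Unlike the other properties, invariance holds for \<open>p k\<close> only up
      to \<open>1 / n k\<close>; for each \<open>e\<close> the closed condition is therefore met
      only from some \<open>k\<close> on.\<close>
    have "\<bar>m (\<alpha> -` A) - m A\<bar> \<le> e" if e: "e > 0" for e
    proof -
      have "closed {q :: 'a set \<Rightarrow> real. \<bar>q (\<alpha> -` A) - q A\<bar> \<le> e}"
        by (auto intro!: closed_Collect_le continuous_intros)
      moreover have "eventually (\<lambda>q. q \<in> {q. \<bar>q (\<alpha> -` A) - q A\<bar> \<le> e}) (filtermap p sequentially)"
        unfolding eventually_filtermap
      proof (rule eventually_sequentiallyI)
        fix k assume k: "nat \<lceil>1 / e\<rceil> \<le> k"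
        have "\<bar>p k (\<alpha> -` A) - p k A\<bar> = \<bar>real (visits \<alpha> (\<alpha> -` A) (n k) (x k)) - real (visits \<alpha> A (n k) (x k))\<bar> / real (n k)"
          by (simp add: p_def flip: diff_divide_distrib)
        also have "\<dots> \<le> 1 / real (n k)"
          by (intro divide_right_mono visits_vimage_diff) simp
        also have "\<dots> \<le> e"
        proof -
          have "1 / e \<le> real (n k)" using k n[of k] by linarith
          then show ?thesis using e n_pos[of k] by (simp add: field_simps)
        qed
        finally show "p k \<in> {q. \<bar>q (\<alpha> -` A) - q A\<bar> \<le> e}" by simp
      qed
      ultimately show ?thesis using cluster_point_mem_closed[OF m] by blast
    qed
    then show ?thesis using dense_ge[of 0 "\<bar>m (\<alpha> -` A) - m A\<bar>"] by auto
  qed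
  obtain \<mu> where \<mu>: "sets \<mu> = sets borel"
    and \<mu>_open: "\<And>U. open U \<Longrightarrow> emeasure \<mu> U = (SUP K\<in>{K. closed K \<and> K \<subseteq> U}. ennreal (m K))"
    and \<mu>_closed: "\<And>K. closed K \<Longrightarrow> ennreal (m K) \<le> emeasure \<mu> K"
    using exists_measure_of_content[OF cpt nonneg add] by blast
  have mono: "m A \<le> m B" if "A \<subseteq> B" for A B
    using add[of A "B - A"] nonneg[of "B - A"] that by (simp add: Un_absorb1)
  have "emeasure \<mu> UNIV = 1"
  proof (rule antisym)
    show "emeasure \<mu> UNIV \<le> 1"
      unfolding \<mu>_open[OF open_UNIV] using mono[of _ UNIV] total by (auto intro!: SUP_least)
    show "1 \<le> emeasure \<mu> UNIV" using \<mu>_closed[of UNIV] total by simp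
  qed
  then have "prob_space \<mu>"
    using sets_eq_imp_space_eq[OF \<mu>] by (intro prob_spaceI) simp
  moreover have "emeasure \<mu> (\<alpha> -` U) = emeasure \<mu> U" if U: "open U" for U
  proof (rule antisym)
    have op: "open (\<alpha> -` U)" using cont U by (simp add: open_vimage)
    show "emeasure \<mu> (\<alpha> -` U) \<le> emeasure \<mu> U"
      unfolding \<mu>_open[OF op] \<mu>_open[OF U]
    proof (rule SUP_mono)
      fix L assume L: "L \<in> {K. closed K \<and> K \<subseteq> \<alpha> -` U}"
      then have "compact L" using cpt by (metis (lifting) closed_Int_compact inf_top_right mem_Collect_eq)
      then have "closed (\<alpha> ` L)"
        using cont by (meson compact_continuous_image compact_imp_closed continuous_on_subset top_greatest)
      moreover have "m L \<le> m (\<alpha> ` L)" using mono[of L "\<alpha> -` (\<alpha> ` L)"] inv[of "\<alpha> ` L"] by auto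
      ultimately show "\<exists>M\<in>{K. closed K \<and> K \<subseteq> U}. ennreal (m L) \<le> ennreal (m M)"
        using L by (intro bexI[of _ "\<alpha> ` L"]) (auto intro: ennreal_leI)
    qed
    show "emeasure \<mu> U \<le> emeasure \<mu> (\<alpha> -` U)"
      unfolding \<mu>_open[OF op] \<mu>_open[OF U]
    proof (rule SUP_mono)
      fix L assume L: "L \<in> {K. closed K \<and> K \<subseteq> U}"
      then have "closed (\<alpha> -` L)" using cont by (simp add: closed_vimage)
      then show "\<exists>M\<in>{K. closed K \<and> K \<subseteq> \<alpha> -` U}. ennreal (m L) \<le> ennreal (m M)"
        using L by (intro bexI[of _ "\<alpha> -` L"]) (auto simp: inv)
    qed
  qed
  ultimately have "\<mu> \<in> invariant_measures \<alpha>" using invariant_measureI[OF _ \<mu> cont] by blast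
  moreover have "ennreal \<delta> \<le> emeasure \<mu> K"
    using \<mu>_closed[OF K] K_ge by (meson ennreal_leI order_trans)
  ultimately show ?thesis by blast
qed

section \<open>The essential set\<close>

lemma closed_essential_set: "closed (essential_set \<alpha>)"
proof -
  have "- essential_set \<alpha> = \<Union> {V. open V \<and> (\<forall>\<mu>\<in>invariant_measures \<alpha>. \<not> emeasure \<mu> V > 0)}"
    unfolding essential_set_def by blast
  then have "open (- essential_set \<alpha>)" by auto
  then show ?thesis by (simp add: closed_def)
qed

text \<open>Each point of \<open>K\<close> has an open neighborhood that is null for
  \<open>\<mu>\<close>, and compactness leaves finitely many of them to cover
  \<open>K\<close>.\<close>

lemma emeasure_zero_of_disjoint_essential_set:
  fixes \<alpha> :: "'a::metric_space \<Rightarrow> 'a"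
  assumes cpt: "compact (UNIV :: 'a set)" and K: "closed K" "K \<inter> essential_set \<alpha> = {}"
    and \<mu>: "\<mu> \<in> invariant_measures \<alpha>"
  shows "emeasure \<mu> K = 0"
proof -
  define C where "C = {V. open V \<and> emeasure \<mu> V = 0}"
  have "K \<subseteq> \<Union>C"
  proof
    fix x assume "x \<in> K"
    then have "x \<notin> essential_set \<alpha>" using K(2) by auto
    then obtain V where "open V" "x \<in> V" "\<not> emeasure \<mu> V > 0"
      using \<mu> unfolding essential_set_def by blast
    then show "x \<in> \<Union>C" by (auto simp: C_def)
  qed
  moreover have "compact K" using cpt K(1) by (metis closed_Int_compact inf_top_right)
  moreover have "\<And>V. V \<in> C \<Longrightarrow> open V" by (simp add: C_def)
  ultimately obtain D where D: "D \<subseteq> C" "finite D" "K \<subseteq> \<Union>D"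
    by (metis compactE)
  have sets: "sets \<mu> = sets borel" using \<mu> by (simp add: invariant_measures_def)
  have "\<Union>D \<in> null_sets \<mu>"
    using D(1,2) by (intro null_sets.finite_Union) (auto simp: C_def null_sets_def sets)
  then have "emeasure \<mu> K \<le> 0" using emeasure_mono[OF D(3), of \<mu>] by (simp add: null_sets_def)
  then show ?thesis by simp
qed

lemma eventually_visits_small:
  fixes \<alpha> :: "'a::metric_space \<Rightarrow> 'a"
  assumes cpt: "compact (UNIV :: 'a set)" and cont: "continuous_on UNIV \<alpha>"
    and K: "closed K" "K \<inter> essential_set \<alpha> = {}" and "\<delta> > 0"
  shows "eventually (\<lambda>n. \<forall>x. real (visits \<alpha> K n x) < \<delta> * real n) sequentially"
proof (rule ccontr)
  assume "\<not> ?thesis"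
  then have "\<exists>n\<ge>N. \<exists>x. \<delta> * real n \<le> real (visits \<alpha> K n x)" for N
    unfolding eventually_sequentially not_less[symmetric] by blast
  then obtain \<mu> where \<mu>: "\<mu> \<in> invariant_measures \<alpha>" "ennreal \<delta> \<le> emeasure \<mu> K"
    using krylov_bogoliubov[OF cpt cont K(1)] by blast
  then show False
    using emeasure_zero_of_disjoint_essential_set[OF cpt K \<mu>(1)] \<open>\<delta> > 0\<close> by simp
qed

text \<open>Otherwise the whole space would be a closed set disjoint from the essential set, yet
  every orbit visits it with frequency 1.\<close>

lemma essential_set_nonempty:
  fixes \<alpha> :: "'a::metric_space \<Rightarrow> 'a"
  assumes "compact (UNIV :: 'a set)" "continuous_on UNIV \<alpha>"
  shows "essential_set \<alpha> \<noteq> {}"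
proof
  assume "essential_set \<alpha> = {}"
  then have "eventually (\<lambda>n. \<forall>x. real (visits \<alpha> UNIV n x) < 1 * real n) sequentially"
    using assms by (intro eventually_visits_small) auto
  then show False by (simp add: visits_UNIV)
qed

lemma essential_set_invariant:
  assumes cont: "continuous_on UNIV \<alpha>" and x: "x \<in> essential_set \<alpha>"
  shows "\<alpha> x \<in> essential_set \<alpha>"
  unfolding essential_set_def
proof (intro CollectI allI impI)
  fix V assume V: "open V" "\<alpha> x \<in> V"
  then have "open (\<alpha> -` V)" "x \<in> \<alpha> -` V" using cont by (auto simp: open_vimage)
  then obtain \<mu> where "\<mu> \<in> invariant_measures \<alpha>" "emeasure \<mu> (\<alpha> -` V) > 0"
    using x unfolding essential_set_def by blast
  then show "\<exists>\<mu>\<in>invariant_measures \<alpha>. 0 < emeasure \<mu> V"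
    using V(1) by (intro bexI[of _ \<mu>]) (auto simp: invariant_measures_def)
qed

lemma essential_set_funpow:
  "continuous_on UNIV \<alpha> \<Longrightarrow> x \<in> essential_set \<alpha> \<Longrightarrow> (\<alpha> ^^ n) x \<in> essential_set \<alpha>"
  by (induction n) (auto intro: essential_set_invariant)

section \<open>Counting itineraries\<close>

lemma bowen_dist_less_iff:
  "n > 0 \<Longrightarrow> bowen_dist \<alpha> n x y < \<epsilon> \<longleftrightarrow> (\<forall>i<n. dist ((\<alpha> ^^ i) x) ((\<alpha> ^^ i) y) < \<epsilon>)"
  unfolding bowen_dist_def by (subst Max_less_iff) auto

text \<open>\<open>l\<close> is the growth rate, and each of the at most \<open>q\<close> visits to \<open>K\<close> costs a factor \<open>B\<close>. The hypothesis
  \<open>bound\<close> is \<open>|E| l\<^sup>-\<^sup>m + |P| (l B)\<^sup>-\<^sup>1 \<le> 1\<close> without fractions: it closes the recursion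
  \<open>N(n,q) \<le> |E| N(n - m,q) + |P| N(n - 1,q - 1)\<close> for the number of itineraries.\<close>

lemma orbit_cover:
  fixes \<alpha> :: "'a::metric_space \<Rightarrow> 'a" and P E :: "'a set"
  assumes P: "finite P" "\<And>x. \<exists>y\<in>P. dist x y < \<epsilon>"
    and E: "finite E" "\<forall>x\<in>- K. \<exists>y\<in>E. \<forall>i<m. dist ((\<alpha> ^^ i) x) ((\<alpha> ^^ i) y) < \<epsilon>"
    and m: "m > 0" and l: "l \<ge> 1" and B: "B \<ge> 1"
    and bound: "real (card E) * (l * B) + real (card P) * l ^ m \<le> l ^ m * (l * B)"
  shows "\<exists>\<A>. finite \<A> \<and> real (card \<A>) \<le> l ^ (n + m) * B ^ q \<and>
    {x. visits \<alpha> K n x \<le> q} \<subseteq> \<Union>\<A> \<and>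
    (\<forall>A\<in>\<A>. \<forall>x\<in>A. \<forall>y\<in>A. \<forall>i<n. dist ((\<alpha> ^^ i) x) ((\<alpha> ^^ i) y) < 2 * \<epsilon>)"
proof (induction n arbitrary: q rule: less_induct)
  case (less n)
  let ?good = "\<lambda>n q c \<A>. finite \<A> \<and> real (card \<A>) \<le> c \<and> {x. visits \<alpha> K n x \<le> q} \<subseteq> \<Union>\<A> \<and>
    (\<forall>A\<in>\<A>. \<forall>x\<in>A. \<forall>y\<in>A. \<forall>i<n. dist ((\<alpha> ^^ i) x) ((\<alpha> ^^ i) y) < 2 * \<epsilon>)"
  have pos: "l > 0" "B > 0" "l ^ k * B ^ j \<ge> 1" for k j
    using l B mult_mono[of 1 "l ^ k" 1 "B ^ j"] by auto
  show ?case
  proof (cases n)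
    case 0
    \<comment> \<open>No times \<open>i < 0\<close> have to be controlled, so one set
      suffices.\<close>
    then show ?thesis using pos(3)[of m q] by (intro exI[of _ "{UNIV}"]) auto
  next
    case (Suc n')
    \<comment> \<open>For \<open>n < m\<close> the truncated difference is 0 and
      \<open>{UNIV}\<close> serves; the induction hypothesis would give only
      \<open>l ^ m * B ^ q\<close>, which may exceed \<open>l ^ n * B ^ q\<close>.\<close>
    have "\<exists>\<A>. ?good (n - m) q (l ^ n * B ^ q) \<A>"
    proof (cases "n < m")
      case True
      then show ?thesis using pos(3)[of n q] by (intro exI[of _ "{UNIV}"]) auto
    next
      case False
      then show ?thesis using less.IH[of "n - m" q] m Suc by simp
    qed
    then obtain \<A> where \<A>: "?good (n - m) q (l ^ n * B ^ q) \<A>" ..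
    obtain \<B> where \<B>: "finite \<B>" "B * real (card \<B>) \<le> l ^ (n' + m) * B ^ q"
      "\<And>x. visits \<alpha> K n' x < q \<Longrightarrow> x \<in> \<Union>\<B>"
      "\<And>A x y i. A \<in> \<B> \<Longrightarrow> x \<in> A \<Longrightarrow> y \<in> A \<Longrightarrow> i < n' \<Longrightarrow> dist ((\<alpha> ^^ i) x) ((\<alpha> ^^ i) y) < 2 * \<epsilon>"
    proof (cases q)
      case 0
      then show ?thesis using pos by (intro that[of "{}"]) auto
    next
      case (Suc q')
      obtain \<B> where \<B>: "?good n' q' (l ^ (n' + m) * B ^ q') \<B>"
        using less.IH[of n' q'] \<open>n = Suc n'\<close> by auto
      have "B * real (card \<B>) \<le> B * (l ^ (n' + m) * B ^ q')"
        using \<B> pos by (intro mult_left_mono) auto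
      then show ?thesis using \<B> Suc
        by (intro that[of \<B>]) (auto simp: algebra_simps less_Suc_eq_le)
    qed
    \<comment> \<open>First pieces of an itinerary: \<open>g\<close> shadows \<open>y\<close> in
      \<open>E\<close> for \<open>m\<close> steps, \<open>h\<close> makes a single step from near
      \<open>y\<close> in \<open>P\<close>; both then continue in \<open>A\<close>.\<close>
    define g where "g = (\<lambda>(y, A). {x. (\<forall>i<m. dist ((\<alpha> ^^ i) x) ((\<alpha> ^^ i) y) < \<epsilon>) \<and> (\<alpha> ^^ m) x \<in> A})"
    define h where "h = (\<lambda>(y, A). {x. dist x y < \<epsilon> \<and> \<alpha> x \<in> A})"
    define \<C> where "\<C> = g ` (E \<times> \<A>) \<union> h ` (P \<times> \<B>)"
    have fin: "finite \<C>" using \<A> \<B>(1) P(1) E(1) by (auto simp: \<C>_def)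
    have near: "dist u v < 2 * \<epsilon>" if "dist u y < \<epsilon>" "dist v y < \<epsilon>" for u v y :: 'a
      using dist_triangle2[of u v y] that by simp
    have "card \<C> \<le> card E * card \<A> + card P * card \<B>"
      unfolding \<C>_def card_cartesian_product[symmetric]
      using \<A> \<B>(1) P(1) E(1) by (intro order_trans[OF card_Un_le] add_mono card_image_le) auto
    \<comment> \<open>Multiplying by \<open>l * B\<close> brings the recursion into the shape of
      \<open>bound\<close>; the factor is cancelled at the end.\<close>
    then have "real (card \<C>) * (l * B) \<le> (real (card E) * real (card \<A>) + real (card P) * real (card \<B>)) * (l * B)"
      using pos by (intro mult_right_mono) (auto simp flip: of_nat_mult of_nat_add)
    also have "\<dots> = real (card E) * (l * B) * real (card \<A>) + real (card P) * l * (B * real (card \<B>))"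
      by (simp add: algebra_simps)
    also have "\<dots> \<le> real (card E) * (l * B) * (l ^ n * B ^ q) + real (card P) * l * (l ^ (n' + m) * B ^ q)"
      using \<A> \<B> pos by (intro add_mono mult_left_mono) auto
    also have "\<dots> = (real (card E) * (l * B) + real (card P) * l ^ m) * (l ^ n * B ^ q)"
      by (simp add: Suc power_add algebra_simps)
    also have "\<dots> \<le> (l ^ m * (l * B)) * (l ^ n * B ^ q)"
      using bound pos by (intro mult_right_mono) auto
    also have "\<dots> = (l ^ (n + m) * B ^ q) * (l * B)" by (simp add: power_add)
    finally have card: "real (card \<C>) \<le> l ^ (n + m) * B ^ q"
      using pos by (subst (asm) mult_le_cancel_right_pos) auto
    have cover: "{x. visits \<alpha> K n x \<le> q} \<subseteq> \<Union>\<C>"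
    proof
      fix x assume "x \<in> {x. visits \<alpha> K n x \<le> q}"
      then have x: "visits \<alpha> K n x \<le> q" by simp
      show "x \<in> \<Union>\<C>"
      proof (cases "x \<in> K")
        case True
        then have "visits \<alpha> K n' (\<alpha> x) < q" using x by (simp add: Suc visits_Suc_shift)
        then obtain A where "A \<in> \<B>" "\<alpha> x \<in> A" using \<B>(3) by blast
        moreover obtain y where "y \<in> P" "dist x y < \<epsilon>" using P(2) by blast
        ultimately have "h (y, A) \<in> \<C>" "x \<in> h (y, A)" by (auto simp: \<C>_def h_def)
        then show ?thesis by blast
      next
        case False
        have "visits \<alpha> K (n - m) ((\<alpha> ^^ m) x) \<le> q" by (rule order_trans[OF visits_funpow_le x])
        then obtain A where "A \<in> \<A>" "(\<alpha> ^^ m) x \<in> A" using \<A> by blast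
        moreover obtain y where "y \<in> E" "\<forall>i<m. dist ((\<alpha> ^^ i) x) ((\<alpha> ^^ i) y) < \<epsilon>"
          using E(2) False by blast
        ultimately have "g (y, A) \<in> \<C>" "x \<in> g (y, A)" by (auto simp: \<C>_def g_def)
        then show ?thesis by blast
      qed
    qed
    have small: "dist ((\<alpha> ^^ i) u) ((\<alpha> ^^ i) v) < 2 * \<epsilon>" if "C \<in> \<C>" "u \<in> C" "v \<in> C" "i < n" for C u v i
    proof -
      from that(1) consider y A where "C = g (y, A)" "A \<in> \<A>" | y A where "C = h (y, A)" "A \<in> \<B>"
        unfolding \<C>_def by auto
      then show ?thesis
      proof cases
        case 1
        have uv: "(\<alpha> ^^ m) u \<in> A" "(\<alpha> ^^ m) v \<in> A"
          "\<And>i. i < m \<Longrightarrow> dist ((\<alpha> ^^ i) u) ((\<alpha> ^^ i) y) < \<epsilon>"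
          "\<And>i. i < m \<Longrightarrow> dist ((\<alpha> ^^ i) v) ((\<alpha> ^^ i) y) < \<epsilon>"
          using that(2,3) 1(1) by (auto simp: g_def)
        show ?thesis
        proof (cases "i < m")
          case True
          then show ?thesis using uv near by blast
        next
          case False
          have "(\<alpha> ^^ i) w = (\<alpha> ^^ (i - m)) ((\<alpha> ^^ m) w)" for w
            using False by (metis comp_apply funpow_add le_add_diff_inverse2 not_less)
          moreover have "i - m < n - m" using False that(4) by simp
          ultimately show ?thesis using \<A> 1(2) uv(1,2) by simp
        qed
      next
        case 2
        have uv: "\<alpha> u \<in> A" "\<alpha> v \<in> A" "dist u y < \<epsilon>" "dist v y < \<epsilon>"
          using that(2,3) 2(1) by (auto simp: h_def)
        show ?thesis
        proof (cases i)
          case 0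
          then show ?thesis using near uv by simp
        next
          case (Suc i')
          then show ?thesis using \<B>(4)[OF 2(2) uv(1,2), of i'] that(4) \<open>n = Suc n'\<close>
            by (simp add: funpow_swap1)
        qed
      qed
    qed
    show ?thesis
      by (intro exI[of _ \<C>] conjI ballI allI impI) (fact fin card cover small)+
  qed
qed

section \<open>From itineraries to the growth of spanning sets\<close>

lemma spanning_for_mono:
  "spanning_for \<alpha> Y n \<epsilon> E \<Longrightarrow> \<epsilon> \<le> \<epsilon>' \<Longrightarrow> spanning_for \<alpha> Y n \<epsilon>' E"
  unfolding spanning_for_def by (meson less_le_trans)

lemma card_root_le:
  assumes "n > 0" "finite A" "real (card A) \<le> c ^ n" "0 \<le> c"
  shows "card_root n A \<le> ereal c"
proof -
  have "root n (real (card A)) \<le> root n (c ^ n)" using assms by simp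
  also have "\<dots> = c" using assms by (simp add: real_root_power_cancel)
  finally show ?thesis using assms(2) by (simp add: card_root_def)
qed

lemma card_root_inj_on_le:
  assumes "inj_on f A" "f ` A \<subseteq> B" "n > 0"
  shows "card_root n A \<le> card_root n B"
proof (cases "finite B")
  case True
  then have "finite A" "card A \<le> card B"
    using assms inj_on_finite card_inj_on_le by blast+
  then show ?thesis using True assms(3) by (simp add: card_root_def)
qed (simp add: card_root_def)

lemma card_root_ge_1: "A \<noteq> {} \<Longrightarrow> n > 0 \<Longrightarrow> 1 \<le> card_root n A"
  by (auto simp: card_root_def Suc_le_eq card_gt_0_iff)

lemma exists_spanning_of_small_cover:
  assumes "finite \<A>" "\<Union>\<A> = UNIV" "n > 0"
    and small: "\<forall>A\<in>\<A>. \<forall>x\<in>A. \<forall>y\<in>A. \<forall>i<n. dist ((\<alpha> ^^ i) x) ((\<alpha> ^^ i) y) < \<epsilon>"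
  shows "\<exists>E. finite E \<and> card E \<le> card \<A> \<and> spanning_for \<alpha> UNIV n \<epsilon> E"
proof (intro exI conjI)
  \<comment> \<open>An empty member of \<open>\<A>\<close> contributes an arbitrary point, which is
    harmless in a set spanning for \<open>UNIV\<close>.\<close>
  let ?E = "(\<lambda>A. SOME x. x \<in> A) ` \<A>"
  show "finite ?E" "card ?E \<le> card \<A>" using assms(1) by (auto intro: card_image_le)
  show "spanning_for \<alpha> UNIV n \<epsilon> ?E"
    unfolding spanning_for_def
  proof (intro conjI ballI)
    fix x
    obtain A where A: "A \<in> \<A>" "x \<in> A" using assms(2) by blast
    then have "bowen_dist \<alpha> n x (SOME x. x \<in> A) < \<epsilon>"
      using small someI[of "\<lambda>x. x \<in> A" x] assms(3) by (simp add: bowen_dist_less_iff)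
    then show "\<exists>y\<in>?E. bowen_dist \<alpha> n x y < \<epsilon>" using A(1) by blast
  qed simp
qed

text \<open>One block length \<open>m\<close> controls all \<open>n\<close>: off a closed set
  \<open>- U\<close> that misses the essential set, orbits are shadowed by \<open>E\<close> for
  \<open>m\<close> steps, and \<open>- U\<close> is visited less than \<open>\<delta> * n\<close>
  times. So \<open>orbit_cover\<close> yields about \<open>l ^ n * B powr (\<delta> * n)\<close>
  sets, and \<open>\<delta>\<close> is arbitrarily small. The scale doubles because two points are
  compared through a common shadow.\<close>

lemma limsup_spanning_le:
  fixes \<alpha> :: "'a::metric_space \<Rightarrow> 'a"
  assumes cpt: "compact (UNIV :: 'a set)" and cont: "continuous_on UNIV \<alpha>"
    and \<epsilon>: "\<epsilon> > 0" and m: "m > 0"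
    and E: "finite E" "spanning_for \<alpha> (essential_set \<alpha>) m \<epsilon> E"
    and l: "l \<ge> 1" "real (card E) < l ^ m"
  shows "limsup (\<lambda>n. INF E\<in>{E. spanning_for \<alpha> UNIV n (2 * \<epsilon>) E}. card_root n E) \<le> ereal l"
proof -
  define U where "U = (\<Union>y\<in>E. \<Inter>i\<in>{..<m}. {x. dist ((\<alpha> ^^ i) x) ((\<alpha> ^^ i) y) < \<epsilon>})"
  have cont_funpow [continuous_intros]: "continuous_on UNIV (\<alpha> ^^ i)" for i
  proof (induction i)
    case (Suc i)
    then show ?case
      using continuous_on_compose2[OF cont Suc] by (simp add: o_def)
  qed (simp add: id_def)
  have "open U"
    unfolding U_def
    by (intro open_UN ballI open_INT open_Collect_less continuous_intros cont_funpow) auto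
  moreover have "essential_set \<alpha> \<subseteq> U"
    using E(2) m unfolding spanning_for_def U_def by (fastforce simp: bowen_dist_less_iff)
  ultimately have K: "closed (- U)" "- U \<inter> essential_set \<alpha> = {}" by auto
  have E': "\<forall>x\<in>- (- U). \<exists>y\<in>E. \<forall>i<m. dist ((\<alpha> ^^ i) x) ((\<alpha> ^^ i) y) < \<epsilon>"
    by (auto simp: U_def)
  obtain P where P: "finite P" "\<And>x :: 'a. \<exists>y\<in>P. dist x y < \<epsilon>"
  proof -
    obtain P where "finite P" "(UNIV :: 'a set) \<subseteq> (\<Union>x\<in>P. ball x \<epsilon>)"
      using cpt \<epsilon> unfolding compact_eq_totally_bounded by blast
    then show ?thesis by (intro that[of P]) (auto simp: dist_commute subset_eq)
  qed
  \<comment> \<open>The solution of \<open>bound\<close> for \<open>B\<close>; the denominator is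
    positive by \<open>card E < l ^ m\<close>.\<close>
  define B where "B = max 1 (real (card P) * l ^ m / ((l ^ m - real (card E)) * l))"
  have B: "B \<ge> 1" by (simp add: B_def)
  have "real (card P) * l ^ m / ((l ^ m - real (card E)) * l) \<le> B" by (simp add: B_def)
  then have "real (card P) * l ^ m \<le> B * ((l ^ m - real (card E)) * l)"
    using l by (subst (asm) pos_divide_le_eq) auto
  then have bound: "real (card E) * (l * B) + real (card P) * l ^ m \<le> l ^ m * (l * B)"
    by (simp add: algebra_simps)
  have "limsup (\<lambda>n. INF E\<in>{E. spanning_for \<alpha> UNIV n (2 * \<epsilon>) E}. card_root n E) \<le> ereal c"
    if c: "l < c" for c
  proof (rule Limsup_bounded)
    \<comment> \<open>\<open>B\<close> is fixed before \<open>\<delta>\<close>, so the price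
      \<open>B powr \<delta>\<close> of the exceptional visits tends to 1.\<close>
    have "((\<lambda>\<delta>. l * B powr \<delta>) \<longlongrightarrow> l * B powr 0) (at_right 0)"
      using B by (intro tendsto_intros) auto
    then have "eventually (\<lambda>\<delta>. l * B powr \<delta> < c) (at_right 0)"
      using c B by (intro order_tendstoD(2)[where y = "l * B powr 0"]) auto
    then have "eventually (\<lambda>\<delta>. l * B powr \<delta> < c \<and> \<delta> > 0) (at_right 0)"
      using eventually_at_right_less[of 0] by (rule eventually_conj)
    then obtain \<delta> where \<delta>: "\<delta> > 0" "l * B powr \<delta> < c"
      using eventually_happens'[OF trivial_limit_at_right_real] by blast
    \<comment> \<open>This is the \<open>n\<close>-th root of
      \<open>l ^ (n + m) * B powr (\<delta> * n)\<close>; the surplus exponent \<open>m\<close>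
      disappears in the limit.\<close>
    have "(\<lambda>n. l powr (1 + real m / real n) * B powr \<delta>) \<longlonglongrightarrow> l powr (1 + 0) * B powr \<delta>"
      using l by (intro tendsto_intros lim_const_over_n) auto
    then have "eventually (\<lambda>n. l powr (1 + real m / real n) * B powr \<delta> < c) sequentially"
      using \<delta> l by (intro order_tendstoD(2)[where y = "l powr (1 + 0) * B powr \<delta>"]) auto
    moreover have "eventually (\<lambda>n. \<forall>x. real (visits \<alpha> (- U) n x) < \<delta> * real n) sequentially"
      by (rule eventually_visits_small[OF cpt cont K \<delta>(1)])
    ultimately show "eventually (\<lambda>n. (INF E\<in>{E. spanning_for \<alpha> UNIV n (2 * \<epsilon>) E}. card_root n E) \<le> ereal c) sequentially"
      using eventually_gt_at_top[of 0]
    proof eventually_elim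
      case (elim n)
      define q where "q = nat \<lfloor>\<delta> * real n\<rfloor>"
      have q: "real q \<le> \<delta> * real n" using \<delta>(1) by (simp add: q_def)
      have "visits \<alpha> (- U) n x \<le> q" for x
        using elim(2) by (simp add: q_def le_nat_floor less_imp_le)
      obtain \<A> where \<A>: "finite \<A>" "real (card \<A>) \<le> l ^ (n + m) * B ^ q"
          "{x. visits \<alpha> (- U) n x \<le> q} \<subseteq> \<Union>\<A>"
          "\<forall>A\<in>\<A>. \<forall>x\<in>A. \<forall>y\<in>A. \<forall>i<n. dist ((\<alpha> ^^ i) x) ((\<alpha> ^^ i) y) < 2 * \<epsilon>"
      proof -
        from orbit_cover[where K = "- U" and n = n and q = q, OF P E(1) E' m l(1) B bound] show ?thesis
          by (elim exE conjE) (rule that)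
      qed
      have "\<Union>\<A> = UNIV" using \<A>(3) \<open>\<And>x. visits \<alpha> (- U) n x \<le> q\<close> by blast
      then obtain E' where E': "finite E'" "card E' \<le> card \<A>" "spanning_for \<alpha> UNIV n (2 * \<epsilon>) E'"
        using exists_spanning_of_small_cover[OF \<A>(1) _ elim(3) \<A>(4)] by blast
      have "real (card E') \<le> l ^ (n + m) * B ^ q" using \<A>(2) E'(2) by linarith
      also have "\<dots> = l powr (real n + real m) * B powr real q"
        using l B by (simp add: powr_realpow flip: of_nat_add)
      also have "\<dots> \<le> l powr (real n + real m) * B powr (\<delta> * real n)"
        using B q l by (intro mult_left_mono powr_mono) auto
      also have "\<dots> = (l powr (1 + real m / real n) * B powr \<delta>) ^ n"
      proof -
        have "(1 + real m / real n) * real n = real n + real m" using elim(3) by (simp add: field_simps)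
        then have "(l powr (1 + real m / real n)) ^ n = l powr (real n + real m)"
          "(B powr \<delta>) ^ n = B powr (\<delta> * real n)"
          using l B by (simp_all add: powr_powr flip: powr_realpow)
        then show ?thesis by (simp add: power_mult_distrib)
      qed
      also have "\<dots> \<le> c ^ n" using elim(1) l by (intro power_mono) auto
      finally have "card_root n E' \<le> ereal c"
        using elim(3) E'(1) c l by (intro card_root_le) auto
      then show ?case using E'(3) by (intro INF_lower2[of E']) auto
    qed
  qed
  note le = this
  show ?thesis
  proof (rule dense_ge)
    fix y assume "ereal l < y"
    then show "limsup (\<lambda>n. INF E\<in>{E. spanning_for \<alpha> UNIV n (2 * \<epsilon>) E}. card_root n E) \<le> y"
      using le by (cases y) auto
  qed
qed

section \<open>Entropies and fibres\<close>

lemma ln_ereal_mono: "x \<le> y \<Longrightarrow> ln_ereal x \<le> ln_ereal y"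
  by (cases x; cases y) (auto simp: ln_ereal_def)

lemma ln_ereal_one: "ln_ereal 1 = 0"
  by (simp add: ln_ereal_def)

text \<open>Finer scales only raise \<open>g\<close>, so the one-sided limit exists and is the
  supremum. Estimates of the entropy can then be made at each scale separately.\<close>

lemma Lim_at_right_antimono:
  fixes g :: "real \<Rightarrow> ereal"
  assumes "\<And>\<epsilon> \<epsilon>'. 0 < \<epsilon> \<Longrightarrow> \<epsilon> \<le> \<epsilon>' \<Longrightarrow> g \<epsilon>' \<le> g \<epsilon>"
  shows "Lim (at_right 0) g = (SUP \<epsilon>\<in>{0<..}. g \<epsilon>)"
proof (rule tendsto_Lim)
  show "(g \<longlongrightarrow> (SUP \<epsilon>\<in>{0<..}. g \<epsilon>)) (at_right 0)"
  proof (rule order_tendstoI)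
    fix a assume "a < (SUP \<epsilon>\<in>{0<..}. g \<epsilon>)"
    then obtain \<epsilon>' where \<epsilon>': "\<epsilon>' > 0" "a < g \<epsilon>'" by (auto simp: less_SUP_iff)
    have "eventually (\<lambda>\<epsilon>. \<epsilon> \<in> {0<..<\<epsilon>'}) (at_right 0)"
      by (rule eventually_at_right_real[OF \<epsilon>'(1)])
    then show "eventually (\<lambda>\<epsilon>. a < g \<epsilon>) (at_right 0)"
      by eventually_elim (use assms \<epsilon>' in \<open>auto intro: less_le_trans\<close>)
  next
    fix a assume a: "(SUP \<epsilon>\<in>{0<..}. g \<epsilon>) < a"
    have "eventually (\<lambda>\<epsilon>. \<epsilon> > 0) (at_right (0::real))" by (rule eventually_at_right_less)
    then show "eventually (\<lambda>\<epsilon>. g \<epsilon> < a) (at_right 0)"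
      by eventually_elim (use a in \<open>auto intro: le_less_trans[OF SUP_upper]\<close>)
  qed
qed simp

definition spanning_rate :: "('a::metric_space \<Rightarrow> 'a) \<Rightarrow> real \<Rightarrow> ereal" where
  "spanning_rate \<alpha> \<epsilon> = limsup (\<lambda>n. INF E\<in>{E. spanning_for \<alpha> UNIV n \<epsilon> E}. card_root n E)"

lemma topological_entropy_eq: "topological_entropy \<alpha> = ln_ereal (SUP \<epsilon>\<in>{0<..}. spanning_rate \<alpha> \<epsilon>)"
proof -
  have "spanning_rate \<alpha> \<epsilon>' \<le> spanning_rate \<alpha> \<epsilon>" if "\<epsilon> \<le> \<epsilon>'" for \<epsilon> \<epsilon>'
    unfolding spanning_rate_def
    using that by (intro Limsup_mono always_eventually allI INF_superset_mono) (auto intro: spanning_for_mono)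
  then show ?thesis
    unfolding topological_entropy_def spanning_rate_def[symmetric] by (subst Lim_at_right_antimono) auto
qed

definition fibre_rate :: "('a::metric_space \<Rightarrow> 'a) \<Rightarrow> ereal" where
  "fibre_rate \<alpha> = limsup (\<lambda>n. SUP x\<in>essential_set \<alpha>. card_root n (essential_preimage \<alpha> n {x}))"

lemma inverse_rami_rate_eq: "inverse_rami_rate \<alpha> = ln_ereal (fibre_rate \<alpha>)"
  by (simp add: inverse_rami_rate_def fibre_rate_def)

section \<open>Vanishing of the forward entropy\<close>

lemma property_starE:
  assumes "property_star \<alpha>" "\<epsilon> > 0"
  obtains F where "\<And>n. n > 0 \<Longrightarrow> finite (F n)" "\<And>n. n > 0 \<Longrightarrow> F n \<subseteq> essential_set \<alpha>"
    "\<And>n. n > 0 \<Longrightarrow> spanning_for \<alpha> (essential_set \<alpha>) n \<epsilon> (essential_preimage \<alpha> n (F n))"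
    "(\<lambda>n. root n (real (card (F n)))) \<longlonglongrightarrow> 1"
proof -
  obtain F where F: "\<forall>n>0. \<forall>\<epsilon>>0. finite (F n \<epsilon>) \<and> F n \<epsilon> \<subseteq> essential_set \<alpha> \<and>
           spanning_for \<alpha> (essential_set \<alpha>) n \<epsilon> (essential_preimage \<alpha> n (F n \<epsilon>))"
      "\<forall>\<epsilon>>0. (\<lambda>n. root n (real (card (F n \<epsilon>)))) \<longlonglongrightarrow> 1"
    using assms(1) unfolding property_star_def by blast
  show ?thesis using F assms(2) by (intro that[of "\<lambda>n. F n \<epsilon>"]) auto
qed

lemma spanning_for_nonempty: "spanning_for \<alpha> Y n \<epsilon> E \<Longrightarrow> Y \<noteq> {} \<Longrightarrow> E \<noteq> {}"
  unfolding spanning_for_def by blast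

text \<open>The rate is 1 already at each fixed \<open>\<epsilon>\<close>:
  \<open>\<alpha> ^^ n\<close> maps the preimage of \<open>F n\<close> back into \<open>F n\<close>,
  and from below the image of a nonempty set has at least one point. With an empty essential set,
  \<open>{}\<close> would be spanning and the value \<open>- \<infinity>\<close>.\<close>

lemma forward_entropy_zero:
  fixes \<alpha> :: "'a::metric_space \<Rightarrow> 'a"
  assumes ne: "essential_set \<alpha> \<noteq> {}" and star: "property_star \<alpha>"
  shows "forward_entropy \<alpha> = 0"
proof -
  let ?r = "\<lambda>\<epsilon> n. INF E\<in>{E. spanning_for \<alpha> (essential_set \<alpha>) n \<epsilon> E}. card_root n ((\<alpha> ^^ n) ` E)"
  have rate: "limsup (?r \<epsilon>) = 1" if \<epsilon>: "\<epsilon> > 0" for \<epsilon>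
  proof (rule lim_imp_Limsup)
    obtain F where F: "\<And>n. n > 0 \<Longrightarrow> finite (F n)"
      "\<And>n. n > 0 \<Longrightarrow> spanning_for \<alpha> (essential_set \<alpha>) n \<epsilon> (essential_preimage \<alpha> n (F n))"
      "(\<lambda>n. root n (real (card (F n)))) \<longlonglongrightarrow> 1"
      using property_starE[OF star \<epsilon>] by metis
    show "?r \<epsilon> \<longlonglongrightarrow> 1"
    proof (rule tendsto_sandwich)
      show "eventually (\<lambda>n. 1 \<le> ?r \<epsilon> n) sequentially"
        using eventually_gt_at_top[of 0]
        by eventually_elim (use ne in \<open>auto intro!: INF_greatest card_root_ge_1 dest: spanning_for_nonempty\<close>)
      show "eventually (\<lambda>n. ?r \<epsilon> n \<le> ereal (root n (real (card (F n))))) sequentially"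
        using eventually_gt_at_top[of 0]
      proof eventually_elim
        case (elim n)
        let ?E = "essential_preimage \<alpha> n (F n)"
        have "?r \<epsilon> n \<le> card_root n ((\<alpha> ^^ n) ` ?E)"
          using F(2)[OF elim] by (intro INF_lower) auto
        also have "\<dots> \<le> card_root n (F n)"
          using elim by (intro card_root_inj_on_le[of id]) (auto simp: essential_preimage_def)
        finally show ?case using F(1)[OF elim] by (simp add: card_root_def)
      qed
      show "(\<lambda>n. ereal (root n (real (card (F n))))) \<longlonglongrightarrow> 1"
        using F(3) by (simp add: one_ereal_def)
    qed simp
  qed simp
  have "Lim (at_right 0) (\<lambda>\<epsilon>. limsup (?r \<epsilon>)) = 1"
  proof (rule tendsto_Lim)
    show "((\<lambda>\<epsilon>. limsup (?r \<epsilon>)) \<longlongrightarrow> 1) (at_right 0)"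
      by (rule tendsto_eventually)
        (auto intro!: eventually_mono[OF eventually_at_right_less] rate)
  qed simp
  then show ?thesis by (simp add: forward_entropy_def ln_ereal_one)
qed

section \<open>Upper bound by the growth of fibres\<close>

lemma finite_essential_preimage:
  assumes cont: "continuous_on UNIV \<alpha>" and fs: "finite_sheeted \<alpha>" and x: "x \<in> essential_set \<alpha>"
  shows "finite (essential_preimage \<alpha> n {x})"
  using x
proof (induction n arbitrary: x)
  case 0
  have "essential_preimage \<alpha> 0 {x} \<subseteq> {x}" by (auto simp: essential_preimage_def)
  then show ?case by (rule finite_subset) simp
next
  case (Suc n)
  \<comment> \<open>Forward invariance puts the last intermediate point
    \<open>(\<alpha> ^^ n) z\<close> into the essential set, hence into the one-step fibre of
    \<open>x\<close>.\<close>
  have "essential_preimage \<alpha> (Suc n) {x} \<subseteq> (\<Union>y\<in>essential_preimage \<alpha> 1 {x}. essential_preimage \<alpha> n {y})"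
    using essential_set_funpow[OF cont] by (auto simp: essential_preimage_def)
  moreover have "finite (essential_preimage \<alpha> 1 {x})"
    using fs Suc.prems unfolding finite_sheeted_def by blast
  moreover have "finite (essential_preimage \<alpha> n {y})" if "y \<in> essential_preimage \<alpha> 1 {x}" for y
    using that by (intro Suc.IH) (auto simp: essential_preimage_def)
  ultimately show ?case by (meson finite_UN_I finite_subset)
qed

text \<open>A spanning set of the essential set is nonempty, so some fibre over \<open>F n\<close>
  is nonempty; the scale 1 is arbitrary. This makes every \<open>l\<close> above the fibre rate an
  admissible growth rate in \<open>limsup_spanning_le\<close>.\<close>

lemma fibre_rate_ge_1:
  assumes ne: "essential_set \<alpha> \<noteq> {}" and star: "property_star \<alpha>"
  shows "1 \<le> fibre_rate \<alpha>"
proof -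
  obtain F where F: "\<And>n. n > 0 \<Longrightarrow> F n \<subseteq> essential_set \<alpha>"
      "\<And>n. n > 0 \<Longrightarrow> spanning_for \<alpha> (essential_set \<alpha>) n 1 (essential_preimage \<alpha> n (F n))"
    using property_starE[OF star, of 1] by (metis zero_less_one)
  have "eventually (\<lambda>n. 1 \<le> (SUP x\<in>essential_set \<alpha>. card_root n (essential_preimage \<alpha> n {x}))) sequentially"
    using eventually_gt_at_top[of 0]
  proof eventually_elim
    case (elim n)
    obtain y where "y \<in> essential_preimage \<alpha> n (F n)"
      using spanning_for_nonempty[OF F(2)[OF elim] ne] by blast
    then have "(\<alpha> ^^ n) y \<in> essential_set \<alpha>" "y \<in> essential_preimage \<alpha> n {(\<alpha> ^^ n) y}"
      using F(1)[OF elim] by (auto simp: essential_preimage_def)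
    then show ?case
      using elim by (intro SUP_upper2[of "(\<alpha> ^^ n) y"] card_root_ge_1) auto
  qed
  then have "limsup (\<lambda>n. 1) \<le> fibre_rate \<alpha>" unfolding fibre_rate_def by (rule Limsup_mono)
  then show ?thesis by (simp add: Limsup_const)
qed

lemma card_UN_le_of_bound:
  assumes "finite F" "\<And>x. x \<in> F \<Longrightarrow> real (card (A x)) \<le> c"
  shows "real (card (\<Union>x\<in>F. A x)) \<le> real (card F) * c"
proof -
  have "real (card (\<Union>x\<in>F. A x)) \<le> (\<Sum>x\<in>F. real (card (A x)))"
    using card_UN_le[OF assms(1), of A] by (simp flip: of_nat_sum)
  also have "\<dots> \<le> real (card F) * c" using sum_mono[of F "\<lambda>x. real (card (A x))" "\<lambda>_. c"] assms by simp
  finally show ?thesis .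
qed

text \<open>For real \<open>l\<close> above the fibre rate choose \<open>c\<close> in between. At
  one large \<open>m\<close> the fibres have at most \<open>c ^ m\<close> points and
  \<open>F m\<close> fewer than \<open>(l / c) ^ m\<close>, so the preimage of \<open>F m\<close>
  spans with fewer than \<open>l ^ m\<close> points.\<close>

lemma spanning_rate_le_fibre_rate:
  fixes \<alpha> :: "'a::metric_space \<Rightarrow> 'a"
  assumes cpt: "compact (UNIV :: 'a set)" and cont: "continuous_on UNIV \<alpha>"
    and fs: "finite_sheeted \<alpha>" and star: "property_star \<alpha>" and \<epsilon>: "\<epsilon> > 0"
  shows "spanning_rate \<alpha> \<epsilon> \<le> fibre_rate \<alpha>"
proof (rule dense_ge)
  fix y assume y: "fibre_rate \<alpha> < y"
  have ge1: "1 \<le> fibre_rate \<alpha>"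
    using essential_set_nonempty[OF cpt cont] star by (rule fibre_rate_ge_1)
  obtain z where z: "fibre_rate \<alpha> < z" "z < y" using y dense by blast
  show "spanning_rate \<alpha> \<epsilon> \<le> y"
  proof (cases y)
    case (real l)
    obtain c where c: "z = ereal c" using z ge1 real by (cases z) auto
    have lc: "1 < c" "c < l" using z ge1 real c
      by (auto simp: one_ereal_def dest: le_less_trans)
    \<comment> \<open>The scale \<open>\<epsilon> / 2\<close> makes up for the doubling in
      \<open>limsup_spanning_le\<close>.\<close>
    obtain F where F: "\<And>n. n > 0 \<Longrightarrow> finite (F n)" "\<And>n. n > 0 \<Longrightarrow> F n \<subseteq> essential_set \<alpha>"
      "\<And>n. n > 0 \<Longrightarrow> spanning_for \<alpha> (essential_set \<alpha>) n (\<epsilon> / 2) (essential_preimage \<alpha> n (F n))"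
      "(\<lambda>n. root n (real (card (F n)))) \<longlonglongrightarrow> 1"
      by (rule property_starE[OF star half_gt_zero[OF \<epsilon>]]) (rule that)
    have "eventually (\<lambda>n. (SUP x\<in>essential_set \<alpha>. card_root n (essential_preimage \<alpha> n {x})) < ereal c) sequentially"
      using z(1) c unfolding fibre_rate_def by (intro Limsup_lessD) auto
    moreover have "eventually (\<lambda>n. root n (real (card (F n))) < l / c) sequentially"
      using lc by (intro order_tendstoD[OF F(4)]) (simp add: field_simps)
    ultimately have "eventually (\<lambda>n. 0 < n \<and> root n (real (card (F n))) < l / c \<and>
      (SUP x\<in>essential_set \<alpha>. card_root n (essential_preimage \<alpha> n {x})) < ereal c) sequentially"
      using eventually_gt_at_top[of 0] by eventually_elim auto
    then obtain m where m: "0 < m" "root m (real (card (F m))) < l / c"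
      "(SUP x\<in>essential_set \<alpha>. card_root m (essential_preimage \<alpha> m {x})) < ereal c"
      using eventually_happens'[OF sequentially_bot] by blast
    have root_less: "a < b ^ m" if "root m a < b" "0 \<le> a" for a b :: real
      using power_strict_mono[OF that(1), of m] that(2) m(1) by (simp add: real_root_pow_pos2)
    let ?E = "essential_preimage \<alpha> m (F m)"
    have E_eq: "?E = (\<Union>x\<in>F m. essential_preimage \<alpha> m {x})" by (auto simp: essential_preimage_def)
    have fibre: "real (card (essential_preimage \<alpha> m {x})) \<le> c ^ m" if "x \<in> F m" for x
    proof -
      have x: "x \<in> essential_set \<alpha>" using that F(2)[OF m(1)] by blast
      have "card_root m (essential_preimage \<alpha> m {x}) < ereal c"
        using m(3) x by (meson SUP_upper le_less_trans)
      then show ?thesis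
        using finite_essential_preimage[OF cont fs x] root_less by (simp add: card_root_def less_imp_le)
    qed
    have fin: "finite ?E"
      unfolding E_eq using F(1,2)[OF m(1)] finite_essential_preimage[OF cont fs] by blast
    have "real (card ?E) \<le> real (card (F m)) * c ^ m"
      unfolding E_eq using F(1)[OF m(1)] fibre by (rule card_UN_le_of_bound)
    also have "\<dots> < (l / c) ^ m * c ^ m"
      using root_less[OF m(2)] lc by (intro mult_strict_right_mono) auto
    also have "\<dots> = l ^ m" using lc by (simp flip: power_mult_distrib)
    finally have "real (card ?E) < l ^ m" .
    then have "limsup (\<lambda>n. INF E\<in>{E. spanning_for \<alpha> UNIV n (2 * (\<epsilon> / 2)) E}. card_root n E) \<le> ereal l"
      using \<epsilon> lc by (intro limsup_spanning_le[OF cpt cont _ m(1) fin F(3)[OF m(1)]]) auto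
    then show ?thesis by (simp add: spanning_rate_def real)
  qed (use y ge1 in auto)
qed

section \<open>Lower bound for coverings\<close>

text \<open>Sheets over evenly covered sets are relatively open with \<open>\<alpha>\<close>
  injective on them; a Lebesgue number of this cover of \<open>S\<close> is the required
  \<open>\<epsilon>\<close>.\<close>

lemma covering_space_separated:
  fixes \<alpha> :: "'a::metric_space \<Rightarrow> 'b::topological_space"
  assumes cpt: "compact S" and cov: "covering_space S \<alpha> T"
  shows "\<exists>\<epsilon>>0. \<forall>x\<in>S. \<forall>y\<in>S. \<alpha> x = \<alpha> y \<longrightarrow> dist x y < \<epsilon> \<longrightarrow> x = y"
proof -
  let ?C = "{U. open U \<and> inj_on \<alpha> (S \<inter> U)}"
  have "S \<subseteq> \<Union>?C"
  proof
    fix x assume x: "x \<in> S"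
    then have "\<alpha> x \<in> T" using cov by (auto simp: covering_space_def)
    then obtain W v where W: "\<alpha> x \<in> W" "\<Union>v = S \<inter> \<alpha> -` W" "\<forall>u\<in>v. openin (top_of_set S) u"
        "\<forall>u\<in>v. \<exists>q. homeomorphism u W \<alpha> q"
      using cov unfolding covering_space_def by metis
    then obtain u q where u: "x \<in> u" "openin (top_of_set S) u" "homeomorphism u W \<alpha> q"
      using x by (metis IntI UnionE vimageI)
    then obtain U where "open U" "u = S \<inter> U" unfolding openin_open by blast
    moreover have "inj_on \<alpha> u" using u(3) by (auto simp: homeomorphism_def intro: inj_on_inverseI[of u q])
    ultimately show "x \<in> \<Union>?C" using u(1) by blast
  qed
  then obtain e where e: "e > 0" "\<And>x. x \<in> S \<Longrightarrow> \<exists>U\<in>?C. ball x e \<subseteq> U"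
    using Heine_Borel_lemma[OF cpt, of ?C] by blast
  have "x = y" if xy: "x \<in> S" "y \<in> S" "\<alpha> x = \<alpha> y" "dist x y < e" for x y
  proof -
    obtain U where U: "inj_on \<alpha> (S \<inter> U)" "ball x e \<subseteq> U" using e(2)[OF xy(1)] by blast
    then have "x \<in> U" "y \<in> U" using e(1) xy(4) by auto
    then show ?thesis using U(1) xy(1-3) by (auto dest: inj_onD)
  qed
  then show ?thesis using e(1) by blast
qed

text \<open>Two orbits that meet at time \<open>n\<close> and were close before already agree at
  time \<open>n - 1\<close>, by \<open>sep\<close>; descend to time 0.\<close>

lemma separated_fibre:
  fixes \<alpha> :: "'a::metric_space \<Rightarrow> 'a"
  assumes inv: "\<And>x. x \<in> S \<Longrightarrow> \<alpha> x \<in> S"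
    and sep: "\<And>x y. x \<in> S \<Longrightarrow> y \<in> S \<Longrightarrow> \<alpha> x = \<alpha> y \<Longrightarrow> dist x y < \<epsilon> \<Longrightarrow> x = y"
    and "x \<in> S" "y \<in> S" "(\<alpha> ^^ n) x = (\<alpha> ^^ n) y"
    and "\<forall>i<n. dist ((\<alpha> ^^ i) x) ((\<alpha> ^^ i) y) < \<epsilon>"
  shows "x = y"
  using assms(3-)
proof (induction n)
  case (Suc n)
  have orbit: "(\<alpha> ^^ k) z \<in> S" if "z \<in> S" for k z
    using that by (induction k) (auto intro: inv)
  have "(\<alpha> ^^ n) x = (\<alpha> ^^ n) y"
    using Suc.prems orbit by (intro sep[of "(\<alpha> ^^ n) x" "(\<alpha> ^^ n) y"]) auto
  then show ?case using Suc by auto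
qed simp

text \<open>Sending each point to an \<open>\<epsilon>\<close>-close member of \<open>E\<close> is
  injective on a fibre of \<open>\<alpha> ^^ n\<close>: points with the same image stay within
  \<open>2 * \<epsilon>\<close> at all times below \<open>n\<close>, hence coincide.\<close>

lemma fibre_rate_le_spanning_rate:
  fixes \<alpha> :: "'a::metric_space \<Rightarrow> 'a"
  assumes cont: "continuous_on UNIV \<alpha>"
    and sep: "\<And>x y. x \<in> essential_set \<alpha> \<Longrightarrow> y \<in> essential_set \<alpha> \<Longrightarrow> \<alpha> x = \<alpha> y \<Longrightarrow> dist x y < 2 * \<epsilon> \<Longrightarrow> x = y"
  shows "fibre_rate \<alpha> \<le> spanning_rate \<alpha> \<epsilon>"
  unfolding fibre_rate_def spanning_rate_def
proof (rule Limsup_mono)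
  show "eventually (\<lambda>n. (SUP x\<in>essential_set \<alpha>. card_root n (essential_preimage \<alpha> n {x})) \<le>
    (INF E\<in>{E. spanning_for \<alpha> UNIV n \<epsilon> E}. card_root n E)) sequentially"
    using eventually_gt_at_top[of 0]
  proof eventually_elim
    case (elim n)
    have "card_root n (essential_preimage \<alpha> n {x}) \<le> card_root n E"
      if E: "spanning_for \<alpha> UNIV n \<epsilon> E" for x E
    proof -
      obtain f where f: "\<And>z. f z \<in> E" "\<And>z. bowen_dist \<alpha> n z (f z) < \<epsilon>"
        using E unfolding spanning_for_def by (metis UNIV_I)
      have "inj_on f (essential_preimage \<alpha> n {x})"
      proof (rule inj_onI)
        fix u v assume uv: "u \<in> essential_preimage \<alpha> n {x}" "v \<in> essential_preimage \<alpha> n {x}" "f u = f v"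
        have "dist ((\<alpha> ^^ i) u) ((\<alpha> ^^ i) v) < 2 * \<epsilon>" if "i < n" for i
          using f(2)[of u] f(2)[of v] uv(3) that elim
            dist_triangle2[of "(\<alpha> ^^ i) u" "(\<alpha> ^^ i) v" "(\<alpha> ^^ i) (f u)"]
          by (fastforce simp: bowen_dist_less_iff)
        then show "u = v"
          using uv(1,2)
          by (intro separated_fibre[OF essential_set_invariant[OF cont] sep, where x = u and y = v and n = n])
            (auto simp: essential_preimage_def)
      qed
      then show ?thesis using f(1) elim by (intro card_root_inj_on_le) auto
    qed
    then show ?case by (intro SUP_least INF_greatest) auto
  qed
qed

text \<open>A bound on fibre cardinalities serves the upper bound on
  \<open>topological_entropy\<close>, but does not keep the points of a fibre apart. The lower bound
  takes this from the local injectivity of a covering map, hence the extra premise of the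
  equality.\<close>

theorem lemma11:
  fixes \<alpha> :: "'a::metric_space \<Rightarrow> 'a"
  assumes "compact (UNIV :: 'a set)"
    and "continuous_on UNIV \<alpha>"
    and "finite_sheeted \<alpha>"
    and "property_star \<alpha>"
  shows "forward_entropy \<alpha> = 0 \<and>
    topological_entropy \<alpha> \<le> inverse_rami_rate \<alpha> \<and>
    (covering_space (essential_set \<alpha>) \<alpha> (essential_set \<alpha>) \<longrightarrow>
      topological_entropy \<alpha> = inverse_rami_rate \<alpha>)"
proof -
  have forward: "forward_entropy \<alpha> = 0"
    using essential_set_nonempty[OF assms(1,2)] assms(4) by (rule forward_entropy_zero)
  have upper: "topological_entropy \<alpha> \<le> inverse_rami_rate \<alpha>"
    unfolding topological_entropy_eq inverse_rami_rate_eq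
    using spanning_rate_le_fibre_rate[OF assms] by (intro ln_ereal_mono SUP_least) auto
  have lower: "inverse_rami_rate \<alpha> \<le> topological_entropy \<alpha>"
    if cov: "covering_space (essential_set \<alpha>) \<alpha> (essential_set \<alpha>)"
  proof -
    have "compact (essential_set \<alpha>)"
      using closed_Int_compact[OF closed_essential_set assms(1)] by simp
    then obtain \<epsilon> where \<epsilon>: "\<epsilon> > 0"
      "\<And>x y. x \<in> essential_set \<alpha> \<Longrightarrow> y \<in> essential_set \<alpha> \<Longrightarrow> \<alpha> x = \<alpha> y \<Longrightarrow> dist x y < \<epsilon> \<Longrightarrow> x = y"
      using covering_space_separated[OF _ cov] by blast
    have "fibre_rate \<alpha> \<le> spanning_rate \<alpha> (\<epsilon> / 2)"
      using \<epsilon>(2) by (intro fibre_rate_le_spanning_rate[OF assms(2)]) auto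
    also have "\<dots> \<le> (SUP \<epsilon>\<in>{0<..}. spanning_rate \<alpha> \<epsilon>)"
      using \<epsilon>(1) by (intro SUP_upper) auto
    finally show ?thesis
      unfolding topological_entropy_eq inverse_rami_rate_eq by (rule ln_ereal_mono)
  qed
  show ?thesis using forward upper lower by (auto intro: antisym)
qed

end
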